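(* Let $b\in B_4$ be a braid (with associated permutation $(2~3)$) such that, for every braided category ${\mathcal V}$, the canonical data with underlying braid $b$ form a monoidal structure on ${\mathcal V}$-Cat. Then in general there is no braiding on ${\mathcal V}$-Cat based upon the braiding $c$ of ${\mathcal V}$, nor based upon any odd power of it: for every integer $n$ there exists a braided category $({\mathcal V},\otimes,\alpha,c,I)$ such that the family $c^{(1)}$ based upon $c^{2n+1}$ is not a braiding on ${\mathcal V}$-Cat equipped with this tensor product.
   Context: A braided category $({\mathcal V},\otimes,\alpha,c,I)$ is a monoidal category with invertible associator $\alpha$, strict two-sided unit $I$ and a braiding $c$. For $m\ge1$, $c^m_{AB}=c_{AB}\circ c_{BA}\circ c_{AB}\circ\cdots$ with $m$ alternating instances of $c$ arranged to have domain $A\otimes B$; negative powers are formed likewise from the inverse braiding $c^{-1}$ (with components $c_{BA}^{-1}:A\otimes B\to B\otimes A$). $B_4$ is the braid group on four strands. The underlying braid of a composite of instances of $c^{\pm1}$ and $\alpha^{\pm1}$ is the braid with a crossing for each $c$ and an inverse crossing for each $c^{-1}$. For $b\in B_4$ with permutation $(2~3)$, $\eta_{(b)}:(X\otimes Y)\otimes(Z\otimes W)\to(X\otimes Z)\otimes(Y\otimes W)$ is the natural transformation built from $\alpha$ and $c$ with underlying braid $b$ (well defined by coherence). ${\mathcal V}$-Cat is the 2-category of small ${\mathcal V}$-enriched categories, ${\mathcal V}$-functors and ${\mathcal V}$-natural transformations; a ${\mathcal V}$-category ${\mathcal A}$ has composition $M:{\mathcal A}(B,C)\otimes{\mathcal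 A}(A,B)\to{\mathcal A}(A,C)$ and units $j_A:I\to{\mathcal A}(A,A)$. Canonical data on ${\mathcal V}$-Cat with underlying braid $b$: the tensor product ${\mathcal A}\otimes{\mathcal B}$ has objects $|{\mathcal A}|\times|{\mathcal B}|$, hom-objects $({\mathcal A}\otimes{\mathcal B})((A,B),(A',B'))={\mathcal A}(A,A')\otimes{\mathcal B}(B,B')$, unit morphisms $I\cong I\otimes I\xrightarrow{j_A\otimes j_B}{\mathcal A}(A,A)\otimes{\mathcal B}(B,B)$, and composition $(M_{AA'A''}\otimes M_{BB'B''})\circ\eta_{(b)}$, where $\eta_{(b)}$ (the "middle four interchange") has domain $({\mathcal A}(A',A'')\otimes{\mathcal B}(B',B''))\otimes({\mathcal A}(A,A')\otimes{\mathcal B}(B,B'))$; the unit is the ${\mathcal V}$-category ${\mathcal I}$ with one object $0$ and ${\mathcal I}(0,0)=I$; the associator $\alpha^{(1)}$ is based upon $\alpha$, i.e. $\alpha^{(1)}((A,B),C)=(A,(B,C))$ on objects and it is $\alpha_{{\mathcal A}(A,A'){\mathcal B}(B,B'){\mathcal C}(C,C')}$ on hom-objects. These data form a monoidal structure when the products are ${\mathcal V}$-categories, the associator consists of ${\mathcal V}$-functors, and the usual monoidal 2-category axioms hold with ${\mathcal I}$ as unit. The family $c^{(1)}$ based upon $c^{2n+1}$ has components $c^{(1)}_{{\mathcal A}{\mathcal B}}:{\mathcal A}\otimes{\mathcal B}\to{\mathcal B}\otimes{\mathcal A}$ given on objects by $(A,B)\mapsto(B,A)$ and on hom-objects by $c^{2n+1}_{{\mathcal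 A}(A,A'){\mathcal B}(B,B')}:{\mathcal A}(A,A')\otimes{\mathcal B}(B,B')\to{\mathcal B}(B,B')\otimes{\mathcal A}(A,A')$. For $c^{(1)}$ to be a braiding on ${\mathcal V}$-Cat, each component must in particular be a ${\mathcal V}$-functor. *)

theory Defs
  imports "HOL-Combinatorics.Transposition" "HOL-Library.Infinite_Typeclass"
begin

section \<open>Braided categories with a strict unit\<close>

record ('o, 'm) braided_data =
  Obj :: "'o set"
  Arr :: "'m set"
  Dom :: "'m \<Rightarrow> 'o"
  Cod :: "'m \<Rightarrow> 'o"
  Id :: "'o \<Rightarrow> 'm"
  Comp :: "'m \<Rightarrow> 'm \<Rightarrow> 'm" (infixr "\<cdot>\<index>" 55)
  TObj :: "'o \<Rightarrow> 'o \<Rightarrow> 'o" (infixl "\<otimes>\<index>" 70)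
  TArr :: "'m \<Rightarrow> 'm \<Rightarrow> 'm" (infixl "\<boxtimes>\<index>" 70)
  Unit :: "'o" ("\<I>\<index>")
  Assoc :: "'o \<Rightarrow> 'o \<Rightarrow> 'o \<Rightarrow> 'm"
  Brd :: "'o \<Rightarrow> 'o \<Rightarrow> 'm"

definition Hom :: "('o, 'm) braided_data \<Rightarrow> 'o \<Rightarrow> 'o \<Rightarrow> 'm set" where
  "Hom V X Y = {f \<in> Arr V. Dom V f = X \<and> Cod V f = Y}"

definition is_inverse :: "('o, 'm) braided_data \<Rightarrow> 'm \<Rightarrow> 'm \<Rightarrow> bool" where
  "is_inverse V f g \<longleftrightarrow> g \<in> Hom V (Cod V f) (Dom V f) \<and>
     g \<cdot>\<^bsub>V\<^esub> f = Id V (Dom V f) \<and> f \<cdot>\<^bsub>V\<^esub> g = Id V (Cod V f)"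

definition Inv :: "('o, 'm) braided_data \<Rightarrow> 'm \<Rightarrow> 'm" where
  "Inv V f = (THE g. is_inverse V f g)"

locale braided_category =
  fixes V :: "('o, 'm) braided_data" (structure)
  assumes dom_cod: "f \<in> Arr V \<Longrightarrow> Dom V f \<in> Obj V \<and> Cod V f \<in> Obj V"
    and id_hom: "X \<in> Obj V \<Longrightarrow> Id V X \<in> Hom V X X"
    and comp_hom: "f \<in> Hom V X Y \<Longrightarrow> g \<in> Hom V Y Z \<Longrightarrow> g \<cdot> f \<in> Hom V X Z"
    and comp_id: "f \<in> Hom V X Y \<Longrightarrow> f \<cdot> Id V X = f"
    and id_comp: "f \<in> Hom V X Y \<Longrightarrow> Id V Y \<cdot> f = f"
    and comp_assoc: "f \<in> Hom V W X \<Longrightarrow> g \<in> Hom V X Y \<Longrightarrow> h \<in> Hom V Y Z \<Longrightarrow>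
      (h \<cdot> g) \<cdot> f = h \<cdot> (g \<cdot> f)"
    and tensor_obj: "X \<in> Obj V \<Longrightarrow> Y \<in> Obj V \<Longrightarrow> X \<otimes> Y \<in> Obj V"
    and tensor_hom: "f \<in> Hom V X X' \<Longrightarrow> g \<in> Hom V Y Y' \<Longrightarrow>
      f \<boxtimes> g \<in> Hom V (X \<otimes> Y) (X' \<otimes> Y')"
    and tensor_id: "X \<in> Obj V \<Longrightarrow> Y \<in> Obj V \<Longrightarrow> Id V X \<boxtimes> Id V Y = Id V (X \<otimes> Y)"
    and tensor_comp: "f \<in> Hom V X X' \<Longrightarrow> f' \<in> Hom V X' X'' \<Longrightarrow>
      g \<in> Hom V Y Y' \<Longrightarrow> g' \<in> Hom V Y' Y'' \<Longrightarrow>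
      (f' \<cdot> f) \<boxtimes> (g' \<cdot> g) = (f' \<boxtimes> g') \<cdot> (f \<boxtimes> g)"
    and unit_obj: "\<I> \<in> Obj V"
    and unit_left_obj: "X \<in> Obj V \<Longrightarrow> \<I> \<otimes> X = X"
    and unit_right_obj: "X \<in> Obj V \<Longrightarrow> X \<otimes> \<I> = X"
    and unit_left_arr: "f \<in> Arr V \<Longrightarrow> Id V \<I> \<boxtimes> f = f"
    and unit_right_arr: "f \<in> Arr V \<Longrightarrow> f \<boxtimes> Id V \<I> = f"
    and assoc_hom: "X \<in> Obj V \<Longrightarrow> Y \<in> Obj V \<Longrightarrow> Z \<in> Obj V \<Longrightarrow>
      Assoc V X Y Z \<in> Hom V ((X \<otimes> Y) \<otimes> Z) (X \<otimes> (Y \<otimes> Z))"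
    and assoc_iso: "X \<in> Obj V \<Longrightarrow> Y \<in> Obj V \<Longrightarrow> Z \<in> Obj V \<Longrightarrow>
      \<exists>g. is_inverse V (Assoc V X Y Z) g"
    and assoc_natural: "f \<in> Hom V X X' \<Longrightarrow> g \<in> Hom V Y Y' \<Longrightarrow> h \<in> Hom V Z Z' \<Longrightarrow>
      Assoc V X' Y' Z' \<cdot> ((f \<boxtimes> g) \<boxtimes> h) = (f \<boxtimes> (g \<boxtimes> h)) \<cdot> Assoc V X Y Z"
    and pentagon: "W \<in> Obj V \<Longrightarrow> X \<in> Obj V \<Longrightarrow> Y \<in> Obj V \<Longrightarrow> Z \<in> Obj V \<Longrightarrow>
      Assoc V W X (Y \<otimes> Z) \<cdot> Assoc V (W \<otimes> X) Y Z =
      (Id V W \<boxtimes> Assoc V X Y Z) \<cdot> Assoc V W (X \<otimes> Y) Z \<cdot> (Assoc V W X Y \<boxtimes> Id V Z)"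
    and triangle: "X \<in> Obj V \<Longrightarrow> Y \<in> Obj V \<Longrightarrow> Assoc V X \<I> Y = Id V (X \<otimes> Y)"
    and braid_hom: "X \<in> Obj V \<Longrightarrow> Y \<in> Obj V \<Longrightarrow> Brd V X Y \<in> Hom V (X \<otimes> Y) (Y \<otimes> X)"
    and braid_iso: "X \<in> Obj V \<Longrightarrow> Y \<in> Obj V \<Longrightarrow> \<exists>g. is_inverse V (Brd V X Y) g"
    and braid_natural: "f \<in> Hom V X X' \<Longrightarrow> g \<in> Hom V Y Y' \<Longrightarrow>
      Brd V X' Y' \<cdot> (f \<boxtimes> g) = (g \<boxtimes> f) \<cdot> Brd V X Y"
    and hexagon1: "X \<in> Obj V \<Longrightarrow> Y \<in> Obj V \<Longrightarrow> Z \<in> Obj V \<Longrightarrow>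
      Assoc V Y Z X \<cdot> Brd V X (Y \<otimes> Z) \<cdot> Assoc V X Y Z =
      (Id V Y \<boxtimes> Brd V X Z) \<cdot> Assoc V Y X Z \<cdot> (Brd V X Y \<boxtimes> Id V Z)"
    and hexagon2: "X \<in> Obj V \<Longrightarrow> Y \<in> Obj V \<Longrightarrow> Z \<in> Obj V \<Longrightarrow>
      Inv V (Assoc V Z X Y) \<cdot> Brd V (X \<otimes> Y) Z \<cdot> Inv V (Assoc V X Y Z) =
      (Brd V X Z \<boxtimes> Id V Y) \<cdot> Inv V (Assoc V X Z Y) \<cdot> (Id V X \<boxtimes> Brd V Y Z)"

text \<open>Alternating composites of a family with components
  \<open>d X Y : X \<otimes> Y \<rightarrow> Y \<otimes> X\<close>; the domain is always \<open>X \<otimes> Y\<close>.\<close>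

primrec alt_power ::
  "('o, 'm) braided_data \<Rightarrow> ('o \<Rightarrow> 'o \<Rightarrow> 'm) \<Rightarrow> nat \<Rightarrow> 'o \<Rightarrow> 'o \<Rightarrow> 'm" where
  "alt_power V d 0 = (\<lambda>X Y. Id V (X \<otimes>\<^bsub>V\<^esub> Y))"
| "alt_power V d (Suc k) = (\<lambda>X Y. alt_power V d k Y X \<cdot>\<^bsub>V\<^esub> d X Y)"

definition brd_power :: "('o, 'm) braided_data \<Rightarrow> int \<Rightarrow> 'o \<Rightarrow> 'o \<Rightarrow> 'm" where
  "brd_power V m =
     (if 0 \<le> m then alt_power V (Brd V) (nat m)
      else alt_power V (\<lambda>X Y. Inv V (Brd V Y X)) (nat (- m)))"


section \<open>Braid groups\<close>

text \<open>A letter \<open>(i, True)\<close> is the Artin generator \<open>\<sigma>\<^sub>i\<close>, crossing the strands in positions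
  \<open>i\<close> and \<open>i + 1\<close> (positions count from 1), and \<open>(i, False)\<close> is its inverse.
  Words are read from left to right: the first letter is the crossing performed first.\<close>

type_synonym braid_word = "(nat \<times> bool) list"

definition braid_words :: "nat \<Rightarrow> braid_word set" where
  "braid_words n = {w. \<forall>(i, e) \<in> set w. 1 \<le> i \<and> i < n}"

inductive braid_eq :: "nat \<Rightarrow> braid_word \<Rightarrow> braid_word \<Rightarrow> bool" for n where
  refl: "w \<in> braid_words n \<Longrightarrow> braid_eq n w w"
| sym: "braid_eq n v w \<Longrightarrow> braid_eq n w v"
| trans: "braid_eq n u v \<Longrightarrow> braid_eq n v w \<Longrightarrow> braid_eq n u w"
| cancel: "u \<in> braid_words n \<Longrightarrow> v \<in> braid_words n \<Longrightarrow> 1 \<le> i \<Longrightarrow> i < n \<Longrightarrow>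
    braid_eq n (u @ [(i, e), (i, \<not> e)] @ v) (u @ v)"
| far: "u \<in> braid_words n \<Longrightarrow> v \<in> braid_words n \<Longrightarrow> 1 \<le> i \<Longrightarrow> i + 2 \<le> j \<Longrightarrow> j < n \<Longrightarrow>
    braid_eq n (u @ [(i, True), (j, True)] @ v) (u @ [(j, True), (i, True)] @ v)"
| artin: "u \<in> braid_words n \<Longrightarrow> v \<in> braid_words n \<Longrightarrow> 1 \<le> i \<Longrightarrow> i + 1 < n \<Longrightarrow>
    braid_eq n (u @ [(i, True), (i + 1, True), (i, True)] @ v)
               (u @ [(i + 1, True), (i, True), (i + 1, True)] @ v)"

text \<open>The set of elements of the braid group \<open>B\<^sub>n\<close>.\<close>

definition braid_group :: "nat \<Rightarrow> braid_word set set" where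
  "braid_group n = braid_words n // {(v, w). braid_eq n v w}"

text \<open>\<open>word_perm w\<close> sends the initial position of a strand to its final position.\<close>

primrec word_perm :: "braid_word \<Rightarrow> nat \<Rightarrow> nat" where
  "word_perm [] = id"
| "word_perm (x # w) = word_perm w \<circ> Transposition.transpose (fst x) (fst x + 1)"

lemma word_perm_append: "word_perm (v @ w) = word_perm w \<circ> word_perm v"
  by (induction v) (simp_all add: comp_assoc)

lemma transpose_commute_far:
  fixes i j :: nat
  assumes "i + 2 \<le> j"
  shows "Transposition.transpose i (Suc i) \<circ> Transposition.transpose j (Suc j) =
    Transposition.transpose j (Suc j) \<circ> Transposition.transpose i (Suc i)"
  using assms by (auto simp: fun_eq_iff Transposition.transpose_def)

lemma transpose_artin:
  fixes i :: nat
  shows "Transposition.transpose i (Suc i) \<circ> Transposition.transpose (Suc i) (Suc (Suc i)) \<circ>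
      Transposition.transpose i (Suc i) =
    Transposition.transpose (Suc i) (Suc (Suc i)) \<circ> Transposition.transpose i (Suc i) \<circ>
      Transposition.transpose (Suc i) (Suc (Suc i))"
  by (auto simp: fun_eq_iff Transposition.transpose_def)

lemma word_perm_cong: "braid_eq n v w \<Longrightarrow> word_perm v = word_perm w"
proof (induction rule: braid_eq.induct)
  case (far u v i j)
  then show ?case
    using transpose_commute_far[of i j] by (simp add: word_perm_append comp_assoc)
next
  case (artin u v i)
  then show ?case
    using transpose_artin[of i] by (simp add: word_perm_append comp_assoc)
qed (auto simp: word_perm_append comp_assoc)

text \<open>By \<open>word_perm_cong\<close> all words representing \<open>b\<close> have the same permutation.\<close>

definition braid_perm :: "braid_word set \<Rightarrow> nat \<Rightarrow> nat" where
  "braid_perm b = the_elem (word_perm ` b)"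


section \<open>Composites of instances of the braiding and the associator\<close>

datatype tree = Leaf nat | Node tree tree

primrec leaves :: "tree \<Rightarrow> nat" where
  "leaves (Leaf i) = 1"
| "leaves (Node s t) = leaves s + leaves t"

primrec tree_obj :: "('o, 'm) braided_data \<Rightarrow> (nat \<Rightarrow> 'o) \<Rightarrow> tree \<Rightarrow> 'o" where
  "tree_obj V x (Leaf i) = x i"
| "tree_obj V x (Node s t) = tree_obj V x s \<otimes>\<^bsub>V\<^esub> tree_obj V x t"

text \<open>\<open>block p q\<close> is the positive braid in which the first \<open>p\<close> strands pass as a block across the
  following \<open>q\<close> strands: strand \<open>p\<close> moves first, strand \<open>1\<close> last.\<close>

definition block :: "nat \<Rightarrow> nat \<Rightarrow> braid_word" where
  "block p q = concat (map (\<lambda>i. map (\<lambda>j. (i + j, True)) [0..<q]) (rev [1..<p + 1]))"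

definition inv_word :: "braid_word \<Rightarrow> braid_word" where
  "inv_word w = rev (map (\<lambda>(i, e). (i, \<not> e)) w)"

definition shift_word :: "nat \<Rightarrow> braid_word \<Rightarrow> braid_word" where
  "shift_word k w = map (\<lambda>(i, e). (k + i, e)) w"

text \<open>\<open>braid_composite V x s t w f\<close>: the morphism \<open>f\<close> is the component at the objects
  \<open>x 0, x 1, \<dots>\<close> of a composite of instances of \<open>c\<^sup>\<plusminus>\<^sup>1\<close> and \<open>\<alpha>\<^sup>\<plusminus>\<^sup>1\<close> from the bracketed word \<open>s\<close> to
  the bracketed word \<open>t\<close>, and \<open>w\<close> represents the underlying braid of that composite.\<close>

inductive braid_composite ::
  "('o, 'm) braided_data \<Rightarrow> (nat \<Rightarrow> 'o) \<Rightarrow> tree \<Rightarrow> tree \<Rightarrow> braid_word \<Rightarrow> 'm \<Rightarrow> bool"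
  for V :: "('o, 'm) braided_data" and x :: "nat \<Rightarrow> 'o" where
  ident: "braid_composite V x s s [] (Id V (tree_obj V x s))"
| assoc: "braid_composite V x (Node (Node s t) u) (Node s (Node t u)) []
    (Assoc V (tree_obj V x s) (tree_obj V x t) (tree_obj V x u))"
| assoc_inv: "braid_composite V x (Node s (Node t u)) (Node (Node s t) u) []
    (Inv V (Assoc V (tree_obj V x s) (tree_obj V x t) (tree_obj V x u)))"
| cross: "braid_composite V x (Node s t) (Node t s) (block (leaves s) (leaves t))
    (Brd V (tree_obj V x s) (tree_obj V x t))"
| cross_inv: "braid_composite V x (Node s t) (Node t s) (inv_word (block (leaves t) (leaves s)))
    (Inv V (Brd V (tree_obj V x t) (tree_obj V x s)))"
| tensor: "braid_composite V x s t v f \<Longrightarrow> braid_composite V x s' t' w g \<Longrightarrow>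
    braid_composite V x (Node s s') (Node t t') (v @ shift_word (leaves s) w) (f \<boxtimes>\<^bsub>V\<^esub> g)"
| comp: "braid_composite V x s t v f \<Longrightarrow> braid_composite V x t u w g \<Longrightarrow>
    braid_composite V x s u (v @ w) (g \<cdot>\<^bsub>V\<^esub> f)"

text \<open>The component of \<open>\<eta>\<^sub>b : (X \<otimes> Y) \<otimes> (Z \<otimes> W) \<rightarrow> (X \<otimes> Z) \<otimes> (Y \<otimes> W)\<close>. The description is meaningful
  when \<open>b\<close> is an element of the braid group on four strands with permutation (2 3):
  uniqueness is the coherence theorem for braided categories.\<close>

definition eta ::
  "('o, 'm) braided_data \<Rightarrow> braid_word set \<Rightarrow> 'o \<Rightarrow> 'o \<Rightarrow> 'o \<Rightarrow> 'o \<Rightarrow> 'm" where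
  "eta V b X Y Z W =
     (THE f. \<exists>w \<in> b. braid_composite V (\<lambda>i. [X, Y, Z, W] ! i)
        (Node (Node (Leaf 0) (Leaf 1)) (Node (Leaf 2) (Leaf 3)))
        (Node (Node (Leaf 0) (Leaf 2)) (Node (Leaf 1) (Leaf 3))) w f)"


section \<open>The 2-category of enriched categories\<close>

text \<open>In \<open>vcomp A x y z : A(y, z) \<otimes> A(x, y) \<rightarrow> A(x, z)\<close>.\<close>

record ('u, 'o, 'm) vcat =
  vobj :: "'u set"
  vhom :: "'u \<Rightarrow> 'u \<Rightarrow> 'o"
  vcomp :: "'u \<Rightarrow> 'u \<Rightarrow> 'u \<Rightarrow> 'm"
  vunit :: "'u \<Rightarrow> 'm"

locale vcategory =
  fixes V :: "('o, 'm) braided_data" (structure) and A :: "('u, 'o, 'm) vcat"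
  assumes hom_obj: "x \<in> vobj A \<Longrightarrow> y \<in> vobj A \<Longrightarrow> vhom A x y \<in> Obj V"
    and comp_arr: "x \<in> vobj A \<Longrightarrow> y \<in> vobj A \<Longrightarrow> z \<in> vobj A \<Longrightarrow>
      vcomp A x y z \<in> Hom V (vhom A y z \<otimes> vhom A x y) (vhom A x z)"
    and unit_arr: "x \<in> vobj A \<Longrightarrow> vunit A x \<in> Hom V \<I> (vhom A x x)"
    and associativity: "w \<in> vobj A \<Longrightarrow> x \<in> vobj A \<Longrightarrow> y \<in> vobj A \<Longrightarrow> z \<in> vobj A \<Longrightarrow>
      vcomp A w x z \<cdot> (vcomp A x y z \<boxtimes> Id V (vhom A w x)) =
      vcomp A w y z \<cdot> (Id V (vhom A y z) \<boxtimes> vcomp A w x y) \<cdot>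
        Assoc V (vhom A y z) (vhom A x y) (vhom A w x)"
    and unit_left: "x \<in> vobj A \<Longrightarrow> y \<in> vobj A \<Longrightarrow>
      vcomp A x y y \<cdot> (vunit A y \<boxtimes> Id V (vhom A x y)) = Id V (vhom A x y)"
    and unit_right: "x \<in> vobj A \<Longrightarrow> y \<in> vobj A \<Longrightarrow>
      vcomp A x x y \<cdot> (Id V (vhom A x y) \<boxtimes> vunit A x) = Id V (vhom A x y)"

record ('u, 'm) vfun =
  fobj :: "'u \<Rightarrow> 'u"
  fhom :: "'u \<Rightarrow> 'u \<Rightarrow> 'm"

locale vfunctor = dom: vcategory V A + cod: vcategory V B
  for V :: "('o, 'm) braided_data" (structure)
    and A :: "('u, 'o, 'm) vcat" and B :: "('u, 'o, 'm) vcat" +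
  fixes F :: "('u, 'm) vfun"
  assumes obj: "x \<in> vobj A \<Longrightarrow> fobj F x \<in> vobj B"
    and hom: "x \<in> vobj A \<Longrightarrow> y \<in> vobj A \<Longrightarrow>
      fhom F x y \<in> Hom V (vhom A x y) (vhom B (fobj F x) (fobj F y))"
    and preserves_comp: "x \<in> vobj A \<Longrightarrow> y \<in> vobj A \<Longrightarrow> z \<in> vobj A \<Longrightarrow>
      fhom F x z \<cdot> vcomp A x y z =
      vcomp B (fobj F x) (fobj F y) (fobj F z) \<cdot> (fhom F y z \<boxtimes> fhom F x y)"
    and preserves_unit: "x \<in> vobj A \<Longrightarrow> fhom F x x \<cdot> vunit A x = vunit B (fobj F x)"

text \<open>The \<open>\<V>\<close>-natural transformations \<open>F \<Rightarrow> G : A \<rightarrow> B\<close>, with components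
  \<open>\<theta> x : \<I> \<rightarrow> B(F x, G x)\<close>.\<close>

locale vnatural = F: vfunctor V A B F + G: vfunctor V A B G
  for V :: "('o, 'm) braided_data" (structure)
    and A :: "('u, 'o, 'm) vcat" and B :: "('u, 'o, 'm) vcat"
    and F :: "('u, 'm) vfun" and G :: "('u, 'm) vfun" +
  fixes \<theta> :: "'u \<Rightarrow> 'm"
  assumes component: "x \<in> vobj A \<Longrightarrow> \<theta> x \<in> Hom V \<I> (vhom B (fobj F x) (fobj G x))"
    and natural: "x \<in> vobj A \<Longrightarrow> y \<in> vobj A \<Longrightarrow>
      vcomp B (fobj F x) (fobj F y) (fobj G y) \<cdot> (\<theta> y \<boxtimes> fhom F x y) =
      vcomp B (fobj F x) (fobj G x) (fobj G y) \<cdot> (fhom G x y \<boxtimes> \<theta> x)"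

text \<open>Values outside the domain are irrelevant, so cells are compared on the objects of their
  domain \<open>A\<close> only.\<close>

definition vfun_eq :: "('u, 'o, 'm) vcat \<Rightarrow> ('u, 'm) vfun \<Rightarrow> ('u, 'm) vfun \<Rightarrow> bool" where
  "vfun_eq A F G \<longleftrightarrow>
     (\<forall>x \<in> vobj A. fobj F x = fobj G x) \<and> (\<forall>x \<in> vobj A. \<forall>y \<in> vobj A. fhom F x y = fhom G x y)"

definition vnat_eq :: "('u, 'o, 'm) vcat \<Rightarrow> ('u \<Rightarrow> 'm) \<Rightarrow> ('u \<Rightarrow> 'm) \<Rightarrow> bool" where
  "vnat_eq A \<theta> \<phi> \<longleftrightarrow> (\<forall>x \<in> vobj A. \<theta> x = \<phi> x)"

definition vfun_id :: "('o, 'm) braided_data \<Rightarrow> ('u, 'o, 'm) vcat \<Rightarrow> ('u, 'm) vfun" where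
  "vfun_id V A = \<lparr>fobj = id, fhom = (\<lambda>x y. Id V (vhom A x y))\<rparr>"

definition vfun_comp ::
  "('o, 'm) braided_data \<Rightarrow> ('u, 'm) vfun \<Rightarrow> ('u, 'm) vfun \<Rightarrow> ('u, 'm) vfun" where
  "vfun_comp V G F = \<lparr>fobj = fobj G \<circ> fobj F,
     fhom = (\<lambda>x y. fhom G (fobj F x) (fobj F y) \<cdot>\<^bsub>V\<^esub> fhom F x y)\<rparr>"

definition vfun_inverse :: "('o, 'm) braided_data \<Rightarrow> ('u, 'o, 'm) vcat \<Rightarrow> ('u, 'o, 'm) vcat \<Rightarrow>
    ('u, 'm) vfun \<Rightarrow> ('u, 'm) vfun \<Rightarrow> bool" where
  "vfun_inverse V A B F G \<longleftrightarrow> vfunctor V A B F \<and> vfunctor V B A G \<and>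
     vfun_eq A (vfun_comp V G F) (vfun_id V A) \<and> vfun_eq B (vfun_comp V F G) (vfun_id V B)"

definition vnat_id :: "('u, 'o, 'm) vcat \<Rightarrow> ('u, 'm) vfun \<Rightarrow> 'u \<Rightarrow> 'm" where
  "vnat_id B F = (\<lambda>x. vunit B (fobj F x))"

text \<open>Vertical composite of \<open>\<theta> : F \<Rightarrow> G\<close> and \<open>\<phi> : G \<Rightarrow> H\<close>, for V-functors with codomain \<open>B\<close>.\<close>

definition vnat_comp :: "('o, 'm) braided_data \<Rightarrow> ('u, 'o, 'm) vcat \<Rightarrow> ('u, 'm) vfun \<Rightarrow>
    ('u, 'm) vfun \<Rightarrow> ('u, 'm) vfun \<Rightarrow> ('u \<Rightarrow> 'm) \<Rightarrow> ('u \<Rightarrow> 'm) \<Rightarrow> 'u \<Rightarrow> 'm" where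
  "vnat_comp V B F G H \<phi> \<theta> =
     (\<lambda>x. vcomp B (fobj F x) (fobj G x) (fobj H x) \<cdot>\<^bsub>V\<^esub> (\<phi> x \<boxtimes>\<^bsub>V\<^esub> \<theta> x))"

text \<open>The whiskerings \<open>K\<theta>\<close>, for \<open>\<theta> : F \<Rightarrow> G\<close>, and \<open>\<theta>K\<close>.\<close>

definition whisker_left :: "('o, 'm) braided_data \<Rightarrow> ('u, 'm) vfun \<Rightarrow> ('u, 'm) vfun \<Rightarrow>
    ('u, 'm) vfun \<Rightarrow> ('u \<Rightarrow> 'm) \<Rightarrow> 'u \<Rightarrow> 'm" where
  "whisker_left V K F G \<theta> = (\<lambda>x. fhom K (fobj F x) (fobj G x) \<cdot>\<^bsub>V\<^esub> \<theta> x)"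

definition whisker_right :: "('u \<Rightarrow> 'm) \<Rightarrow> ('u, 'm) vfun \<Rightarrow> 'u \<Rightarrow> 'm" where
  "whisker_right \<theta> K = (\<lambda>x. \<theta> (fobj K x))"


section \<open>Monoidal structures and braidings on the 2-category of enriched categories\<close>

record ('u, 'o, 'm) monoidal_data =
  tens0 :: "('u, 'o, 'm) vcat \<Rightarrow> ('u, 'o, 'm) vcat \<Rightarrow> ('u, 'o, 'm) vcat"
  tens1 :: "('u, 'm) vfun \<Rightarrow> ('u, 'm) vfun \<Rightarrow> ('u, 'm) vfun"
  tens2 :: "('u \<Rightarrow> 'm) \<Rightarrow> ('u \<Rightarrow> 'm) \<Rightarrow> 'u \<Rightarrow> 'm"
  unit0 :: "('u, 'o, 'm) vcat"
  asc :: "('u, 'o, 'm) vcat \<Rightarrow> ('u, 'o, 'm) vcat \<Rightarrow> ('u, 'o, 'm) vcat \<Rightarrow> ('u, 'm) vfun"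
  lunit :: "('u, 'o, 'm) vcat \<Rightarrow> ('u, 'm) vfun"
  runit :: "('u, 'o, 'm) vcat \<Rightarrow> ('u, 'm) vfun"

locale monoidal_structure =
  fixes V :: "('o, 'm) braided_data" and D :: "('u, 'o, 'm) monoidal_data"
  assumes tens_vcat: "vcategory V A \<Longrightarrow> vcategory V B \<Longrightarrow> vcategory V (tens0 D A B)"
    and unit_vcat: "vcategory V (unit0 D)"
    and tens_vfun: "vfunctor V A A' F \<Longrightarrow> vfunctor V B B' G \<Longrightarrow>
      vfunctor V (tens0 D A B) (tens0 D A' B') (tens1 D F G)"
    and tens_vfun_cong: "vfunctor V A A' F \<Longrightarrow> vfunctor V A A' F' \<Longrightarrow> vfun_eq A F F' \<Longrightarrow>
      vfunctor V B B' G \<Longrightarrow> vfunctor V B B' G' \<Longrightarrow> vfun_eq B G G' \<Longrightarrow>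
      vfun_eq (tens0 D A B) (tens1 D F G) (tens1 D F' G')"
    and tens_vfun_id: "vcategory V A \<Longrightarrow> vcategory V B \<Longrightarrow>
      vfun_eq (tens0 D A B) (tens1 D (vfun_id V A) (vfun_id V B)) (vfun_id V (tens0 D A B))"
    and tens_vfun_comp: "vfunctor V A A' F \<Longrightarrow> vfunctor V A' A'' F' \<Longrightarrow>
      vfunctor V B B' G \<Longrightarrow> vfunctor V B' B'' G' \<Longrightarrow>
      vfun_eq (tens0 D A B) (tens1 D (vfun_comp V F' F) (vfun_comp V G' G))
        (vfun_comp V (tens1 D F' G') (tens1 D F G))"
    and tens_vnat: "vnatural V A A' F F' \<theta> \<Longrightarrow> vnatural V B B' G G' \<phi> \<Longrightarrow>
      vnatural V (tens0 D A B) (tens0 D A' B') (tens1 D F G) (tens1 D F' G') (tens2 D \<theta> \<phi>)"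
    and tens_vnat_cong: "vnatural V A A' F F' \<theta> \<Longrightarrow> vnatural V A A' F F' \<theta>' \<Longrightarrow> vnat_eq A \<theta> \<theta>' \<Longrightarrow>
      vnatural V B B' G G' \<phi> \<Longrightarrow> vnatural V B B' G G' \<phi>' \<Longrightarrow> vnat_eq B \<phi> \<phi>' \<Longrightarrow>
      vnat_eq (tens0 D A B) (tens2 D \<theta> \<phi>) (tens2 D \<theta>' \<phi>')"
    and tens_vnat_id: "vfunctor V A A' F \<Longrightarrow> vfunctor V B B' G \<Longrightarrow>
      vnat_eq (tens0 D A B) (tens2 D (vnat_id A' F) (vnat_id B' G))
        (vnat_id (tens0 D A' B') (tens1 D F G))"
    and tens_vnat_comp: "vnatural V A A' F F' \<theta> \<Longrightarrow> vnatural V A A' F' F'' \<theta>' \<Longrightarrow>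
      vnatural V B B' G G' \<phi> \<Longrightarrow> vnatural V B B' G' G'' \<phi>' \<Longrightarrow>
      vnat_eq (tens0 D A B)
        (tens2 D (vnat_comp V A' F F' F'' \<theta>' \<theta>) (vnat_comp V B' G G' G'' \<phi>' \<phi>))
        (vnat_comp V (tens0 D A' B') (tens1 D F G) (tens1 D F' G') (tens1 D F'' G'')
          (tens2 D \<theta>' \<phi>') (tens2 D \<theta> \<phi>))"
    and tens_whisker_left: "vnatural V A A' F F' \<theta> \<Longrightarrow> vfunctor V A' A'' K \<Longrightarrow>
      vnatural V B B' G G' \<phi> \<Longrightarrow> vfunctor V B' B'' L \<Longrightarrow>
      vnat_eq (tens0 D A B) (tens2 D (whisker_left V K F F' \<theta>) (whisker_left V L G G' \<phi>))
        (whisker_left V (tens1 D K L) (tens1 D F G) (tens1 D F' G') (tens2 D \<theta> \<phi>))"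
    and tens_whisker_right: "vfunctor V A A' K \<Longrightarrow> vnatural V A' A'' F F' \<theta> \<Longrightarrow>
      vfunctor V B B' L \<Longrightarrow> vnatural V B' B'' G G' \<phi> \<Longrightarrow>
      vnat_eq (tens0 D A B) (tens2 D (whisker_right \<theta> K) (whisker_right \<phi> L))
        (whisker_right (tens2 D \<theta> \<phi>) (tens1 D K L))"
    and asc_iso: "vcategory V A \<Longrightarrow> vcategory V B \<Longrightarrow> vcategory V C \<Longrightarrow>
      \<exists>P. vfun_inverse V (tens0 D (tens0 D A B) C) (tens0 D A (tens0 D B C)) (asc D A B C) P"
    and asc_natural: "vfunctor V A A' F \<Longrightarrow> vfunctor V B B' G \<Longrightarrow> vfunctor V C C' H \<Longrightarrow>
      vfun_eq (tens0 D (tens0 D A B) C)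
        (vfun_comp V (asc D A' B' C') (tens1 D (tens1 D F G) H))
        (vfun_comp V (tens1 D F (tens1 D G H)) (asc D A B C))"
    and asc_2natural: "vnatural V A A' F F' \<theta> \<Longrightarrow> vnatural V B B' G G' \<phi> \<Longrightarrow>
      vnatural V C C' H H' \<psi> \<Longrightarrow>
      vnat_eq (tens0 D (tens0 D A B) C)
        (whisker_left V (asc D A' B' C') (tens1 D (tens1 D F G) H) (tens1 D (tens1 D F' G') H')
          (tens2 D (tens2 D \<theta> \<phi>) \<psi>))
        (whisker_right (tens2 D \<theta> (tens2 D \<phi> \<psi>)) (asc D A B C))"
    and pentagon: "vcategory V A \<Longrightarrow> vcategory V B \<Longrightarrow> vcategory V C \<Longrightarrow> vcategory V E \<Longrightarrow>
      vfun_eq (tens0 D (tens0 D (tens0 D A B) C) E)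
        (vfun_comp V (asc D A B (tens0 D C E)) (asc D (tens0 D A B) C E))
        (vfun_comp V (tens1 D (vfun_id V A) (asc D B C E))
          (vfun_comp V (asc D A (tens0 D B C) E) (tens1 D (asc D A B C) (vfun_id V E))))"
    and lunit_iso: "vcategory V A \<Longrightarrow> \<exists>P. vfun_inverse V (tens0 D (unit0 D) A) A (lunit D A) P"
    and lunit_natural: "vfunctor V A A' F \<Longrightarrow>
      vfun_eq (tens0 D (unit0 D) A)
        (vfun_comp V (lunit D A') (tens1 D (vfun_id V (unit0 D)) F))
        (vfun_comp V F (lunit D A))"
    and lunit_2natural: "vnatural V A A' F F' \<theta> \<Longrightarrow>
      vnat_eq (tens0 D (unit0 D) A)
        (whisker_left V (lunit D A')
          (tens1 D (vfun_id V (unit0 D)) F) (tens1 D (vfun_id V (unit0 D)) F')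
          (tens2 D (vnat_id (unit0 D) (vfun_id V (unit0 D))) \<theta>))
        (whisker_right \<theta> (lunit D A))"
    and runit_iso: "vcategory V A \<Longrightarrow> \<exists>P. vfun_inverse V (tens0 D A (unit0 D)) A (runit D A) P"
    and runit_natural: "vfunctor V A A' F \<Longrightarrow>
      vfun_eq (tens0 D A (unit0 D))
        (vfun_comp V (runit D A') (tens1 D F (vfun_id V (unit0 D))))
        (vfun_comp V F (runit D A))"
    and runit_2natural: "vnatural V A A' F F' \<theta> \<Longrightarrow>
      vnat_eq (tens0 D A (unit0 D))
        (whisker_left V (runit D A')
          (tens1 D F (vfun_id V (unit0 D))) (tens1 D F' (vfun_id V (unit0 D)))
          (tens2 D \<theta> (vnat_id (unit0 D) (vfun_id V (unit0 D)))))
        (whisker_right \<theta> (runit D A))"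
    and triangle: "vcategory V A \<Longrightarrow> vcategory V B \<Longrightarrow>
      vfun_eq (tens0 D (tens0 D A (unit0 D)) B)
        (vfun_comp V (tens1 D (vfun_id V A) (lunit D B)) (asc D A (unit0 D) B))
        (tens1 D (runit D A) (vfun_id V B))"

locale braiding =
  fixes V :: "('o, 'm) braided_data" and D :: "('u, 'o, 'm) monoidal_data"
    and \<gamma> :: "('u, 'o, 'm) vcat \<Rightarrow> ('u, 'o, 'm) vcat \<Rightarrow> ('u, 'm) vfun"
  assumes component: "vcategory V A \<Longrightarrow> vcategory V B \<Longrightarrow>
      vfunctor V (tens0 D A B) (tens0 D B A) (\<gamma> A B)"
    and invertible: "vcategory V A \<Longrightarrow> vcategory V B \<Longrightarrow>
      \<exists>P. vfun_inverse V (tens0 D A B) (tens0 D B A) (\<gamma> A B) P"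
    and natural: "vfunctor V A A' F \<Longrightarrow> vfunctor V B B' G \<Longrightarrow>
      vfun_eq (tens0 D A B) (vfun_comp V (\<gamma> A' B') (tens1 D F G))
        (vfun_comp V (tens1 D G F) (\<gamma> A B))"
    and natural2: "vnatural V A A' F F' \<theta> \<Longrightarrow> vnatural V B B' G G' \<phi> \<Longrightarrow>
      vnat_eq (tens0 D A B)
        (whisker_left V (\<gamma> A' B') (tens1 D F G) (tens1 D F' G') (tens2 D \<theta> \<phi>))
        (whisker_right (tens2 D \<phi> \<theta>) (\<gamma> A B))"
    and hexagon1: "vcategory V A \<Longrightarrow> vcategory V B \<Longrightarrow> vcategory V C \<Longrightarrow>
      vfun_eq (tens0 D (tens0 D A B) C)
        (vfun_comp V (asc D B C A) (vfun_comp V (\<gamma> A (tens0 D B C)) (asc D A B C)))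
        (vfun_comp V (tens1 D (vfun_id V B) (\<gamma> A C))
          (vfun_comp V (asc D B A C) (tens1 D (\<gamma> A B) (vfun_id V C))))"
    and hexagon2: "vcategory V A \<Longrightarrow> vcategory V B \<Longrightarrow> vcategory V C \<Longrightarrow>
      vfun_inverse V (tens0 D (tens0 D A B) C) (tens0 D A (tens0 D B C)) (asc D A B C) P \<Longrightarrow>
      vfun_inverse V (tens0 D (tens0 D A C) B) (tens0 D A (tens0 D C B)) (asc D A C B) Q \<Longrightarrow>
      vfun_inverse V (tens0 D (tens0 D C A) B) (tens0 D C (tens0 D A B)) (asc D C A B) R \<Longrightarrow>
      vfun_eq (tens0 D A (tens0 D B C))
        (vfun_comp V R (vfun_comp V (\<gamma> (tens0 D A B) C) P))
        (vfun_comp V (tens1 D (\<gamma> A C) (vfun_id V B))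
          (vfun_comp V Q (tens1 D (vfun_id V A) (\<gamma> B C))))"


section \<open>The canonical data\<close>

text \<open>Objects of small enriched categories are drawn from a universe that is closed under pairing
  and contains the object 0 of the unit category, so that the enriched categories with objects in
  this universe, for an arbitrary type \<open>'a\<close> of atoms, are closed under the tensor product.\<close>

datatype 'a universe =
  Atom 'a
| Zero
| Pair (pfst: "'a universe") (psnd: "'a universe")

definition tensor_vcat :: "('o, 'm) braided_data \<Rightarrow> braid_word set \<Rightarrow>
    ('a universe, 'o, 'm) vcat \<Rightarrow> ('a universe, 'o, 'm) vcat \<Rightarrow> ('a universe, 'o, 'm) vcat" where
  "tensor_vcat V b A B = \<lparr>
     vobj = {Pair x y | x y. x \<in> vobj A \<and> y \<in> vobj B},
     vhom = (\<lambda>p q. vhom A (pfst p) (pfst q) \<otimes>\<^bsub>V\<^esub> vhom B (psnd p) (psnd q)),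
     vcomp = (\<lambda>p q r.
       (vcomp A (pfst p) (pfst q) (pfst r) \<boxtimes>\<^bsub>V\<^esub> vcomp B (psnd p) (psnd q) (psnd r)) \<cdot>\<^bsub>V\<^esub>
       eta V b (vhom A (pfst q) (pfst r)) (vhom B (psnd q) (psnd r))
               (vhom A (pfst p) (pfst q)) (vhom B (psnd p) (psnd q))),
     vunit = (\<lambda>p. vunit A (pfst p) \<boxtimes>\<^bsub>V\<^esub> vunit B (psnd p))\<rparr>"

definition tensor_vfun :: "('o, 'm) braided_data \<Rightarrow>
    ('a universe, 'm) vfun \<Rightarrow> ('a universe, 'm) vfun \<Rightarrow> ('a universe, 'm) vfun" where
  "tensor_vfun V F G = \<lparr>
     fobj = (\<lambda>p. Pair (fobj F (pfst p)) (fobj G (psnd p))),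
     fhom = (\<lambda>p q. fhom F (pfst p) (pfst q) \<boxtimes>\<^bsub>V\<^esub> fhom G (psnd p) (psnd q))\<rparr>"

definition tensor_vnat :: "('o, 'm) braided_data \<Rightarrow>
    ('a universe \<Rightarrow> 'm) \<Rightarrow> ('a universe \<Rightarrow> 'm) \<Rightarrow> 'a universe \<Rightarrow> 'm" where
  "tensor_vnat V \<theta> \<phi> = (\<lambda>p. \<theta> (pfst p) \<boxtimes>\<^bsub>V\<^esub> \<phi> (psnd p))"

definition unit_vcat :: "('o, 'm) braided_data \<Rightarrow> ('a universe, 'o, 'm) vcat" where
  "unit_vcat V = \<lparr>vobj = {Zero}, vhom = (\<lambda>x y. \<I>\<^bsub>V\<^esub>),
     vcomp = (\<lambda>x y z. Id V \<I>\<^bsub>V\<^esub>), vunit = (\<lambda>x. Id V \<I>\<^bsub>V\<^esub>)\<rparr>"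

definition assoc_vfun :: "('o, 'm) braided_data \<Rightarrow> ('a universe, 'o, 'm) vcat \<Rightarrow>
    ('a universe, 'o, 'm) vcat \<Rightarrow> ('a universe, 'o, 'm) vcat \<Rightarrow> ('a universe, 'm) vfun" where
  "assoc_vfun V A B C = \<lparr>
     fobj = (\<lambda>p. Pair (pfst (pfst p)) (Pair (psnd (pfst p)) (psnd p))),
     fhom = (\<lambda>p q. Assoc V (vhom A (pfst (pfst p)) (pfst (pfst q)))
       (vhom B (psnd (pfst p)) (psnd (pfst q))) (vhom C (psnd p) (psnd q)))\<rparr>"

text \<open>The identifications of \<open>\<I> \<otimes> A\<close> and \<open>A \<otimes> \<I>\<close> with \<open>A\<close>, which are identities on hom-objects
  because the unit of \<open>V\<close> is strict.\<close>

definition lunit_vfun ::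
  "('o, 'm) braided_data \<Rightarrow> ('a universe, 'o, 'm) vcat \<Rightarrow> ('a universe, 'm) vfun" where
  "lunit_vfun V A = \<lparr>fobj = psnd, fhom = (\<lambda>p q. Id V (vhom A (psnd p) (psnd q)))\<rparr>"

definition runit_vfun ::
  "('o, 'm) braided_data \<Rightarrow> ('a universe, 'o, 'm) vcat \<Rightarrow> ('a universe, 'm) vfun" where
  "runit_vfun V A = \<lparr>fobj = pfst, fhom = (\<lambda>p q. Id V (vhom A (pfst p) (pfst q)))\<rparr>"

definition canonical_data ::
  "('o, 'm) braided_data \<Rightarrow> braid_word set \<Rightarrow> ('a universe, 'o, 'm) monoidal_data" where
  "canonical_data V b = \<lparr>
     tens0 = tensor_vcat V b, tens1 = tensor_vfun V, tens2 = tensor_vnat V,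
     unit0 = unit_vcat V, asc = assoc_vfun V, lunit = lunit_vfun V, runit = runit_vfun V\<rparr>"

text \<open>The family \<open>c\<^sup>(\<^sup>1\<^sup>)\<close> based upon \<open>c\<^sup>m\<close>, for odd \<open>m\<close>.\<close>

definition power_family :: "('o, 'm) braided_data \<Rightarrow> int \<Rightarrow>
    ('a universe, 'o, 'm) vcat \<Rightarrow> ('a universe, 'o, 'm) vcat \<Rightarrow> ('a universe, 'm) vfun" where
  "power_family V m A B = \<lparr>
     fobj = (\<lambda>p. Pair (psnd p) (pfst p)),
     fhom = (\<lambda>p q. brd_power V m (vhom A (pfst p) (pfst q)) (vhom B (psnd p) (psnd q)))\<rparr>"

end

theory Submission
  imports Defs "HOL-Library.Countable" "HOL-Library.Product_Plus"
begin

text \<open>The obstruction is the exponent sum of a braid. Functoriality of the component of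
  \<open>c\<^sup>(\<^sup>1\<^sup>)\<close> would force \<open>c\<^sup>m \<circ> \<eta>\<^sub>b = \<eta>\<^sub>b \<circ> (c\<^sup>m \<otimes> c\<^sup>m)\<close>, where on the left whole pairs of
  strands are crossed. Crossing two pairs takes four elementary crossings, so the exponent sums
  exceed that of \<open>b\<close> by \<open>4m\<close> and by \<open>2m\<close>; these differ, as \<open>m\<close> is odd. The exponent sum is detected
  by the category with objects \<open>d \<in> \<int>\<close>, all of whose morphisms are automorphisms \<open>q\<^sup>k\<close> with
  \<open>k \<in> \<int>\<close>, and with \<open>c\<^bsub>d,d'\<^esub> = q\<^sup>d\<^sup>d\<^sup>'\<close>.\<close>

text \<open>\<open>ob d\<close> encodes the object \<open>d\<close>, and \<open>ar (d, k)\<close> the automorphism \<open>q\<^sup>k\<close> of \<open>d\<close>.\<close>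

definition graded_lines :: "(int \<Rightarrow> 'o) \<Rightarrow> (int \<times> int \<Rightarrow> 'm) \<Rightarrow> ('o, 'm) braided_data" where
  "graded_lines ob ar = \<lparr>
     Obj = range ob, Arr = range ar,
     Dom = (\<lambda>f. ob (fst (inv ar f))), Cod = (\<lambda>f. ob (fst (inv ar f))),
     Id = (\<lambda>X. ar (inv ob X, 0)),
     Comp = (\<lambda>g f. ar (fst (inv ar f), snd (inv ar g) + snd (inv ar f))),
     TObj = (\<lambda>X Y. ob (inv ob X + inv ob Y)),
     TArr = (\<lambda>f g. ar (inv ar f + inv ar g)),
     Unit = ob 0,
     Assoc = (\<lambda>X Y Z. ar (inv ob X + inv ob Y + inv ob Z, 0)),
     Brd = (\<lambda>X Y. ar (inv ob X + inv ob Y, inv ob X * inv ob Y))\<rparr>"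

text \<open>Differences of \<open>h\<close> add up along composites, so \<open>q^0\<close> can serve
  as every composition and unit.\<close>

definition potential_vcat ::
  "(int \<Rightarrow> 'o) \<Rightarrow> (int \<times> int \<Rightarrow> 'm) \<Rightarrow> ('u \<Rightarrow> int) \<Rightarrow> ('u, 'o, 'm) vcat" where
  "potential_vcat ob ar h = \<lparr>
     vobj = UNIV, vhom = (\<lambda>x y. ob (h y - h x)),
     vcomp = (\<lambda>x y z. ar (h z - h x, 0)), vunit = (\<lambda>x. ar (0, 0))\<rparr>"

locale line_encoding =
  fixes ob :: "int \<Rightarrow> 'o" and ar :: "int \<times> int \<Rightarrow> 'm"
  assumes inj_ob: "inj ob" and inj_ar: "inj ar"
begin

abbreviation V where "V \<equiv> graded_lines ob ar"

lemma graded_lines_simps [simp]: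
  "Obj V = range ob" "Arr V = range ar"
  "Dom V (ar p) = ob (fst p)" "Cod V (ar p) = ob (fst p)"
  "Id V (ob d) = ar (d, 0)"
  "ar p \<cdot>\<^bsub>V\<^esub> ar r = ar (fst r, snd p + snd r)"
  "ob d \<otimes>\<^bsub>V\<^esub> ob d' = ob (d + d')"
  "ar p \<boxtimes>\<^bsub>V\<^esub> ar r = ar (p + r)"
  "\<I>\<^bsub>V\<^esub> = ob 0"
  "Assoc V (ob d) (ob d') (ob d'') = ar (d + d' + d'', 0)"
  "Brd V (ob d) (ob d') = ar (d + d', d * d')"
  by (simp_all add: graded_lines_def inj_ob inj_ar)

lemma ob_eq_iff [simp]: "ob d = ob d' \<longleftrightarrow> d = d'"
  using inj_ob by (auto dest: injD)

lemma ar_eq_iff [simp]: "ar p = ar r \<longleftrightarrow> p = r"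
  using inj_ar by (auto dest: injD)

lemma Hom_iff: "f \<in> Hom V X Y \<longleftrightarrow> (\<exists>d k. X = ob d \<and> Y = ob d \<and> f = ar (d, k))"
  by (auto simp: Hom_def)

lemma is_inverse_iff: "is_inverse V (ar (d, k)) g \<longleftrightarrow> g = ar (d, - k)"
  by (auto simp: is_inverse_def Hom_iff)

lemma Inv_ar [simp]: "Inv V (ar (d, k)) = ar (d, - k)"
  by (simp add: Inv_def is_inverse_iff)

text \<open>The hexagons amount to bilinearity of \<open>d * d'\<close>.\<close>

lemma braided_category_graded_lines: "braided_category V"
  by unfold_locales (auto simp: Hom_iff is_inverse_iff algebra_simps)

text \<open>The sign \<open>s\<close> treats \<open>c\<close> and its inverse together.\<close>

lemma alt_power_ar:
  assumes "\<And>d d'. c (ob d) (ob d') = ar (d + d', s * (d * d'))"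
  shows "alt_power V c k (ob d) (ob d') = ar (d + d', int k * s * (d * d'))"
  by (induction k arbitrary: d d') (auto simp: assms algebra_simps)

lemma brd_power_ar: "brd_power V m (ob d) (ob d') = ar (d + d', m * (d * d'))"
proof (cases "0 \<le> m")
  case True
  then show ?thesis
    using alt_power_ar[of "Brd V" 1 "nat m"] by (simp add: brd_power_def)
next
  case False
  then show ?thesis
    using alt_power_ar[of "\<lambda>X Y. Inv V (Brd V Y X)" "-1" "nat (- m)"]
    by (simp add: brd_power_def algebra_simps)
qed

lemma vcategory_potential: "vcategory V (potential_vcat ob ar h)"
  by unfold_locales (auto simp: potential_vcat_def Hom_iff)

lemma power_family_not_vfunctor:
  fixes h :: "'a universe \<Rightarrow> int"
  defines "A \<equiv> potential_vcat ob ar h"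
  assumes h: "h y = h x + 1" "h z = h y + 1" and "m \<noteq> 0"
  shows "\<not> vfunctor V (tensor_vcat V b A A) (tensor_vcat V b A A) (power_family V m A A)"
proof
  let ?T = "tensor_vcat V b A A" and ?F = "power_family V m A A"
  let ?x = "Pair x x" and ?y = "Pair y y" and ?z = "Pair z z"
  assume "vfunctor V ?T ?T ?F"
  then interpret vfunctor V ?T ?T ?F .
  have mem: "?x \<in> vobj ?T" "?y \<in> vobj ?T" "?z \<in> vobj ?T"
    by (simp_all add: tensor_vcat_def A_def potential_vcat_def)
  have homs: "vhom ?T ?x ?y = ob 2" "vhom ?T ?y ?z = ob 2"
    using h by (simp_all add: tensor_vcat_def A_def potential_vcat_def)
  text \<open>The value of \<open>\<eta>\<^sub>b\<close> is irrelevant: both sides of the functoriality square contain the same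
    component, since all hom-objects involved have degree 1.\<close>
  obtain t where t: "vcomp ?T ?x ?y ?z = ar (4, t)"
    using dom.comp_arr[OF mem] by (auto simp: homs Hom_iff)
  \<comment> \<open>The swap fixes the diagonal, so \<open>t\<close> enters both sides.\<close>
  have F: "fobj ?F (Pair u u) = Pair u u" for u
    by (simp add: power_family_def)
  have "fhom ?F ?x ?z = ar (4, m * 4)" "fhom ?F ?x ?y = ar (2, m)" "fhom ?F ?y ?z = ar (2, m)"
    using h by (simp_all add: power_family_def A_def potential_vcat_def brd_power_ar)
  \<comment> \<open>The exponents of \<open>q\<close> are \<open>4 * m + t\<close> and
    \<open>t + 2 * m\<close>.\<close>
  with preserves_comp[OF mem] show False
    using \<open>m \<noteq> 0\<close> by (simp add: F t)
qed

lemma power_family_not_braiding: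
  assumes "m \<noteq> 0"
  shows "\<not> braiding V (canonical_data V b :: ('a universe, 'o, 'm) monoidal_data)
    (power_family V m)"
proof
  \<comment> \<open>Levels 0, 1, 2 are reached from \<open>Zero\<close> alone, as \<open>'a\<close>
    may have a single element.\<close>
  let ?h = "\<lambda>x :: 'a universe. if x = Zero then 0 else if x = Pair Zero Zero then 1 else 2"
  let ?A = "potential_vcat ob ar ?h"
  assume "braiding V (canonical_data V b :: ('a universe, 'o, 'm) monoidal_data)
    (power_family V m)"
  from braiding.component[OF this vcategory_potential vcategory_potential]
  have "vfunctor V (tensor_vcat V b ?A ?A) (tensor_vcat V b ?A ?A) (power_family V m ?A ?A)"
    by (simp add: canonical_data_def)
  with assms show False
    using power_family_not_vfunctor[of ?h "Pair Zero Zero" Zero "Pair Zero (Pair Zero Zero)"]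
    by simp
qed

end

theorem theorem6p1:
  fixes b :: "braid_word set"
  assumes "b \<in> braid_group 4"
    and "braid_perm b = Transposition.transpose 2 3"
    and "\<And>V :: ('o::infinite, 'm::infinite) braided_data. braided_category V \<Longrightarrow>
      monoidal_structure V (canonical_data V b :: ('a universe, 'o, 'm) monoidal_data)"
  shows "\<forall>n::int. \<exists>V :: ('o, 'm) braided_data. braided_category V \<and>
    \<not> braiding V (canonical_data V b :: ('a universe, 'o, 'm) monoidal_data)
        (power_family V (2 * n + 1))"
proof
  fix n :: int
  \<comment> \<open>Infinite types contain copies of the countable types \<open>int\<close> and
    \<open>int \<times> int\<close>.\<close>
  obtain o' :: "nat \<Rightarrow> 'o" and a' :: "nat \<Rightarrow> 'm" where "inj o'" "inj a'"
    using infinite_countable_subset[OF infinite_UNIV] by metis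
  then interpret line_encoding "o' \<circ> to_nat" "a' \<circ> to_nat"
    by unfold_locales (simp_all add: inj_compose)
  have "2 * n + 1 \<noteq> 0" by presburger
  then show "\<exists>V :: ('o, 'm) braided_data. braided_category V \<and>
      \<not> braiding V (canonical_data V b :: ('a universe, 'o, 'm) monoidal_data)
        (power_family V (2 * n + 1))"
    using braided_category_graded_lines power_family_not_braiding by blast
qed

end
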